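(* Let $S$ be an $E$-unitary inverse semigroup. The following statements are equivalent. (1) $S$ is an $F$-congruence-free $F$-inverse monoid. (2) $S$ is congruence-free. (3) $S$ is either a simple group or a semilattice with at most two elements.
   Context: For an inverse semigroup $S$, $E(S)$ is its set of idempotents, $\leq$ is the natural partial order ($s\leq t$ iff $s=et$ for some $e\in E(S)$), and $\sigma$ is the minimum group congruence ($s\mathrel{\sigma}t$ iff $es=et$ for some $e\in E(S)$). $S$ is $E$-unitary if $e\in E(S)$ and $e\leq s$ imply $s\in E(S)$ (equivalently, $E(S)$ is a $\sigma$-class). $S$ is $F$-inverse if every $\sigma$-class has a maximum element with respect to $\leq$; such an $S$ is automatically a monoid (and $E$-unitary). For $a$ in an $F$-inverse monoid $S$, $a^{\mathfrak m}$ denotes the maximum element of the $\sigma$-class of $a$. A congruence is an equivalence relation compatible with multiplication on both sides; an $F$-congruence on an $F$-inverse monoid $S$ is a congruence $\rho$ such that $a\mathrel{\rho}b$ implies $a^{\mathfrak m}\mathrel{\rho}b^{\mathfrak m}$ for all $a,b\in S$. An inverse semigroup $S$ is congruence-free if its only congruences are the trivial congruence $\mathrm{id}_S$ (equality) and the universal congruence $\Delta_S=S\times S$. An $F$-inverse monoid $S$ is $F$-congruence-free if its only $F$-congruences are $\mathrm{id}_S$ and $\Delta_S$. Semigroups are nonempty. *)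

theory Defs
  imports "HOL-Algebra.Coset"
begin

locale inverse_semigroup =
  fixes S :: "'a set" and mul :: "'a \<Rightarrow> 'a \<Rightarrow> 'a" (infixl "\<cdot>" 70)
  assumes nonempty: "S \<noteq> {}"
    and closed: "\<lbrakk>a \<in> S; b \<in> S\<rbrakk> \<Longrightarrow> a \<cdot> b \<in> S"
    and assoc: "\<lbrakk>a \<in> S; b \<in> S; c \<in> S\<rbrakk> \<Longrightarrow> (a \<cdot> b) \<cdot> c = a \<cdot> (b \<cdot> c)"
    and ex1_inverse: "a \<in> S \<Longrightarrow> \<exists>!b. b \<in> S \<and> a \<cdot> b \<cdot> a = a \<and> b \<cdot> a \<cdot> b = b"
begin

definition idems :: "'a set" where
  "idems = {e \<in> S. e \<cdot> e = e}"

definition nat_le :: "'a \<Rightarrow> 'a \<Rightarrow> bool" where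
  "nat_le s t \<longleftrightarrow> (\<exists>e \<in> idems. s = e \<cdot> t)"

definition sigma :: "('a \<times> 'a) set" where
  "sigma = {(s, t) \<in> S \<times> S. \<exists>e \<in> idems. e \<cdot> s = e \<cdot> t}"

definition E_unitary :: bool where
  "E_unitary \<longleftrightarrow> (\<forall>e \<in> idems. \<forall>s \<in> S. nat_le e s \<longrightarrow> s \<in> idems)"

definition F_inverse :: bool where
  "F_inverse \<longleftrightarrow> (\<forall>C \<in> S // sigma. \<exists>m \<in> C. \<forall>b \<in> C. nat_le b m)"

text \<open>The existence of an identity follows from \<^const>\<open>F_inverse\<close>; it is listed
  explicitly only so that the definition says monoid.\<close>
definition F_inverse_monoid :: bool where
  "F_inverse_monoid \<longleftrightarrow> F_inverse \<and> (\<exists>u \<in> S. \<forall>a \<in> S. u \<cdot> a = a \<and> a \<cdot> u = a)"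

text \<open>Meaningful when \<^const>\<open>F_inverse\<close> holds; uniqueness is antisymmetry of the
  natural partial order.\<close>
definition max_of :: "'a \<Rightarrow> 'a" where
  "max_of a = (THE m. m \<in> sigma `` {a} \<and> (\<forall>b \<in> sigma `` {a}. nat_le b m))"

definition congruence :: "('a \<times> 'a) set \<Rightarrow> bool" where
  "congruence \<rho> \<longleftrightarrow> equiv S \<rho> \<and>
     (\<forall>(a, b) \<in> \<rho>. \<forall>c \<in> S. (c \<cdot> a, c \<cdot> b) \<in> \<rho> \<and> (a \<cdot> c, b \<cdot> c) \<in> \<rho>)"

definition F_congruence :: "('a \<times> 'a) set \<Rightarrow> bool" where
  "F_congruence \<rho> \<longleftrightarrow> congruence \<rho> \<and> (\<forall>(a, b) \<in> \<rho>. (max_of a, max_of b) \<in> \<rho>)"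

definition congruence_free :: bool where
  "congruence_free \<longleftrightarrow> (\<forall>\<rho>. congruence \<rho> \<longrightarrow> \<rho> = Id_on S \<or> \<rho> = S \<times> S)"

definition F_congruence_free :: bool where
  "F_congruence_free \<longleftrightarrow> (\<forall>\<rho>. F_congruence \<rho> \<longrightarrow> \<rho> = Id_on S \<or> \<rho> = S \<times> S)"

text \<open>The locale \<open>simple_group\<close> of HOL-Algebra asks for \<open>order G > 1\<close>, where the order
  of an infinite group is 0, so it excludes infinite simple groups and is not used here.\<close>
definition is_simple_group :: bool where
  "is_simple_group \<longleftrightarrow> (\<exists>u. let G = \<lparr>carrier = S, mult = mul, one = u\<rparr> in
     group G \<and> S \<noteq> {u} \<and> (\<forall>N. N \<lhd> G \<longrightarrow> N = S \<or> N = {u}))"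

definition is_semilattice :: bool where
  "is_semilattice \<longleftrightarrow> (\<forall>a \<in> S. a \<cdot> a = a) \<and> (\<forall>a \<in> S. \<forall>b \<in> S. a \<cdot> b = b \<cdot> a)"

end

end

theory Submission
  imports Defs
begin

text \<open>
  The minimum group congruence \<open>\<sigma>\<close> is a dichotomy for both kinds of freeness.
  It is a congruence, and on an \<open>F\<close>-inverse semigroup it is an \<open>F\<close>-congruence, because
  \<open>a\<close> and the maximum of its \<open>\<sigma>\<close>-class are \<open>\<sigma>\<close>-related.  Hence under (1) or (2)
  it is either equality or universal.

  In either case the two notions of congruence coincide: if \<open>\<sigma>\<close> is equality then
  every element is the maximum of its own class, and if \<open>\<sigma>\<close> is universal then the
  maximum is the same for all elements; so every congruence respects maxima
  (\<open>congruence_imp_F_congruence\<close>).  This gives (1) \<open>\<Longrightarrow>\<close> (2).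

  For (2) \<open>\<Longrightarrow>\<close> (3), all idempotents are \<open>\<sigma>\<close>-related, so if \<open>\<sigma>\<close> is equality there
  is only one idempotent and \<open>S\<close> is a group, whose congruences correspond to normal
  subgroups.  If \<open>\<sigma>\<close> is universal, \<open>E\<close>-unitarity makes every element idempotent, so
  \<open>S\<close> is a semilattice; there the principal filter of an element \<open>a\<close> and its complement
  are the classes of a congruence, and when this congruence is equality, \<open>S\<close> has at most
  two elements (\<open>congruence_free_semilattice_card\<close>).

  Conversely, simple groups and equivalence relations on sets with at most two elements
  offer no proper nontrivial congruence.  A group is \<open>F\<close>-inverse because its natural
  order is equality, and a semilattice with at most two elements because it is a chain
  forming a single \<open>\<sigma>\<close>-class.
\<close>

context inverse_semigroup
begin

section \<open>Idempotents and the natural partial order\<close>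

lemma idems_in: "e \<in> idems \<Longrightarrow> e \<in> S"
  and idems_idem: "e \<in> idems \<Longrightarrow> e \<cdot> e = e"
  by (auto simp: idems_def)

lemma obtain_inverse:
  assumes "a \<in> S"
  obtains b where "b \<in> S" "a \<cdot> b \<cdot> a = a" "b \<cdot> a \<cdot> b = b"
  using ex1_inverse[OF assms] by blast

lemma inverse_unique:
  assumes "a \<in> S" "b \<in> S" "c \<in> S"
    and "a \<cdot> b \<cdot> a = a" "b \<cdot> a \<cdot> b = b" "a \<cdot> c \<cdot> a = a" "c \<cdot> a \<cdot> c = c"
  shows "b = c"
  using ex1_inverse[OF assms(1)] assms by blast

lemma mult_inverse_idem:
  assumes "a \<in> S" "b \<in> S" "a \<cdot> b \<cdot> a = a"
  shows "a \<cdot> b \<in> idems"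
proof -
  have "(a \<cdot> b) \<cdot> (a \<cdot> b) = (a \<cdot> b \<cdot> a) \<cdot> b"
    using assms(1,2) by (simp add: assoc closed)
  then show ?thesis using assms by (simp add: idems_def closed)
qed

text \<open>If \<open>x\<close> is the inverse of \<open>e \<cdot> f\<close>, then so is \<open>f \<cdot> x \<cdot> e\<close>; thus \<open>x = f \<cdot> x \<cdot> e\<close>, which
  makes \<open>x\<close> idempotent.  An idempotent is its own inverse, so \<open>e \<cdot> f = x\<close>.\<close>

lemma idems_closed:
  assumes e: "e \<in> idems" and f: "f \<in> idems"
  shows "e \<cdot> f \<in> idems"
proof -
  note S = idems_in[OF e] idems_in[OF f]
  have ee: "e \<cdot> (e \<cdot> y) = e \<cdot> y" if "y \<in> S" for y
    using that S assoc[of e e y] idems_idem[OF e] by simp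
  have ff: "f \<cdot> (f \<cdot> y) = f \<cdot> y" if "y \<in> S" for y
    using that S assoc[of f f y] idems_idem[OF f] by simp
  obtain x where x: "x \<in> S" "e \<cdot> f \<cdot> x \<cdot> (e \<cdot> f) = e \<cdot> f" "x \<cdot> (e \<cdot> f) \<cdot> x = x"
    using obtain_inverse[of "e \<cdot> f"] S closed by blast
  have x2: "e \<cdot> (f \<cdot> (x \<cdot> (e \<cdot> f))) = e \<cdot> f" and x3: "x \<cdot> (e \<cdot> (f \<cdot> x)) = x"
    using x S by (simp_all add: assoc closed)
  have x3': "x \<cdot> (e \<cdot> (f \<cdot> (x \<cdot> y))) = x \<cdot> y" if "y \<in> S" for y
  proof -
    have "x \<cdot> (e \<cdot> (f \<cdot> (x \<cdot> y))) = x \<cdot> (e \<cdot> (f \<cdot> x)) \<cdot> y"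
      using that x(1) S by (simp add: assoc closed)
    then show ?thesis using x3 by simp
  qed
  have xfe: "f \<cdot> x \<cdot> e = x"
  proof (rule inverse_unique[of "e \<cdot> f"])
    show "e \<cdot> f \<cdot> (f \<cdot> x \<cdot> e) \<cdot> (e \<cdot> f) = e \<cdot> f"
      using x(1) S x2 by (simp add: assoc closed ee ff)
    show "f \<cdot> x \<cdot> e \<cdot> (e \<cdot> f) \<cdot> (f \<cdot> x \<cdot> e) = f \<cdot> x \<cdot> e"
      using x(1) S x3' by (simp add: assoc closed ee ff)
  qed (use x S closed in auto)
  have "x \<cdot> x = (f \<cdot> x \<cdot> e) \<cdot> (f \<cdot> x \<cdot> e)" using xfe by simp
  also have "\<dots> = f \<cdot> x \<cdot> e"
    using x(1) S x3' by (simp add: assoc closed)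
  finally have xx: "x \<cdot> x = x" using xfe by simp
  have "e \<cdot> f = x"
    by (rule inverse_unique[of x]) (use x xx S closed in auto)
  then show ?thesis using xx x(1) by (simp add: idems_def)
qed

text \<open>Both \<open>e \<cdot> f\<close> and \<open>f \<cdot> e\<close> are inverses of the idempotent \<open>e \<cdot> f\<close>.\<close>

lemma idems_commute:
  assumes e: "e \<in> idems" and f: "f \<in> idems"
  shows "e \<cdot> f = f \<cdot> e"
proof -
  note S = idems_in[OF e] idems_in[OF f]
  have ee: "e \<cdot> (e \<cdot> y) = e \<cdot> y" if "y \<in> S" for y
    using that S assoc[of e e y] idems_idem[OF e] by simp
  have ff: "f \<cdot> (f \<cdot> y) = f \<cdot> y" if "y \<in> S" for y
    using that S assoc[of f f y] idems_idem[OF f] by simp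
  have ef: "e \<cdot> (f \<cdot> (e \<cdot> f)) = e \<cdot> f" and fe: "f \<cdot> (e \<cdot> (f \<cdot> e)) = f \<cdot> e"
    using idems_idem[OF idems_closed[OF e f]] idems_idem[OF idems_closed[OF f e]] S
    by (simp_all add: assoc closed)
  show ?thesis
    by (rule inverse_unique[of "e \<cdot> f"]) (use S ef fe in \<open>simp_all add: assoc closed ee ff\<close>)
qed

lemma nat_le_refl:
  assumes "a \<in> S"
  shows "nat_le a a"
proof -
  obtain b where "b \<in> S" "a \<cdot> b \<cdot> a = a" using obtain_inverse[OF assms] .
  then show ?thesis
    using mult_inverse_idem[OF assms] unfolding nat_le_def by metis
qed

lemma nat_le_antisym:
  assumes st: "nat_le s t" "nat_le t s" and S: "s \<in> S" "t \<in> S"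
  shows "s = t"
proof -
  obtain e f where e: "e \<in> idems" "s = e \<cdot> t" and f: "f \<in> idems" "t = f \<cdot> s"
    using st unfolding nat_le_def by blast
  note E = idems_in[OF e(1)] idems_in[OF f(1)]
  have "e \<cdot> s = s"
    using e(2) idems_idem[OF e(1)] assoc[of e e t] E S by simp
  have "s = e \<cdot> (f \<cdot> s)" using e(2) f(2) by simp
  also have "\<dots> = f \<cdot> (e \<cdot> s)"
    using idems_commute[OF e(1) f(1)] assoc[of e f s] assoc[of f e s] E S by simp
  also have "\<dots> = t" using \<open>e \<cdot> s = s\<close> f(2) by simp
  finally show ?thesis .
qed

section \<open>The minimum group congruence\<close>

lemma sigma_iff: "(s, t) \<in> sigma \<longleftrightarrow> s \<in> S \<and> t \<in> S \<and> (\<exists>e \<in> idems. e \<cdot> s = e \<cdot> t)"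
  by (auto simp: sigma_def)

lemma equiv_sigma: "equiv S sigma"
proof (rule equivI)
  show "sigma \<subseteq> S \<times> S" by (auto simp: sigma_def)
  obtain e where "e \<in> idems"
    using nonempty obtain_inverse mult_inverse_idem by (metis all_not_in_conv)
  then show "refl_on S sigma" by (auto simp: refl_on_def sigma_iff)
  show "sym sigma" by (rule symI) (metis sigma_iff)
  show "trans sigma"
  proof (rule transI)
    fix s t u assume "(s, t) \<in> sigma" "(t, u) \<in> sigma"
    then obtain e f where S: "s \<in> S" "t \<in> S" "u \<in> S"
      and e: "e \<in> idems" "e \<cdot> s = e \<cdot> t" and f: "f \<in> idems" "f \<cdot> t = f \<cdot> u"
      unfolding sigma_iff by blast
    note E = idems_in[OF e(1)] idems_in[OF f(1)]
    have "(f \<cdot> e) \<cdot> s = (f \<cdot> e) \<cdot> t" using e(2) S E by (simp add: assoc)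
    also have "\<dots> = (e \<cdot> f) \<cdot> t" using idems_commute[OF e(1) f(1)] by simp
    also have "\<dots> = (e \<cdot> f) \<cdot> u" using f(2) S E by (simp add: assoc)
    also have "\<dots> = (f \<cdot> e) \<cdot> u" using idems_commute[OF e(1) f(1)] by simp
    finally show "(s, u) \<in> sigma"
      using idems_closed[OF f(1) e(1)] S unfolding sigma_iff by blast
  qed
qed

text \<open>If \<open>e\<close> witnesses that \<open>s\<close> and \<open>t\<close> are related, its conjugate \<open>c \<cdot> e \<cdot> c'\<close>, with \<open>c'\<close>
  the inverse of \<open>c\<close>, witnesses this for \<open>c \<cdot> s\<close> and \<open>c \<cdot> t\<close>.\<close>

lemma sigma_left:
  assumes "(s, t) \<in> sigma" and c: "c \<in> S"
  shows "(c \<cdot> s, c \<cdot> t) \<in> sigma"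
proof -
  obtain e where S: "s \<in> S" "t \<in> S" and e: "e \<in> idems" "e \<cdot> s = e \<cdot> t"
    using assms(1) unfolding sigma_iff by blast
  obtain d where d: "d \<in> S" "c \<cdot> d \<cdot> c = c" "d \<cdot> c \<cdot> d = d" using obtain_inverse[OF c] .
  have E: "e \<in> S" using e idems_in by blast
  have dc: "d \<cdot> c \<in> idems" using mult_inverse_idem[OF d(1) c d(3)] .
  have key: "c \<cdot> (e \<cdot> (d \<cdot> (c \<cdot> x))) = c \<cdot> (e \<cdot> x)" if x: "x \<in> S" for x
  proof -
    have "c \<cdot> (e \<cdot> (d \<cdot> (c \<cdot> x))) = c \<cdot> (e \<cdot> (d \<cdot> c)) \<cdot> x"
      using x c d(1) E by (simp add: assoc closed)
    also have "\<dots> = c \<cdot> (d \<cdot> c \<cdot> e) \<cdot> x"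
      using idems_commute[OF e(1) dc] by simp
    also have "\<dots> = c \<cdot> d \<cdot> c \<cdot> (e \<cdot> x)"
      using x c d(1) E by (simp add: assoc closed)
    finally show ?thesis using d(2) by simp
  qed
  have ee: "e \<cdot> (e \<cdot> d) = e \<cdot> d"
    using assoc[of e e d] E d(1) idems_idem[OF e(1)] by simp
  have "c \<cdot> (e \<cdot> d) \<in> idems"
    using c d(1) E ee key[of "e \<cdot> d"] by (simp add: idems_def assoc closed)
  moreover have "c \<cdot> (e \<cdot> d) \<cdot> (c \<cdot> s) = c \<cdot> (e \<cdot> d) \<cdot> (c \<cdot> t)"
    using c d(1) E S key[of s] key[of t] e(2) by (simp add: assoc closed)
  ultimately show ?thesis using S c closed unfolding sigma_iff by blast
qed

lemma sigma_right:
  assumes "(s, t) \<in> sigma" and c: "c \<in> S"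
  shows "(s \<cdot> c, t \<cdot> c) \<in> sigma"
proof -
  obtain e where S: "s \<in> S" "t \<in> S" and e: "e \<in> idems" "e \<cdot> s = e \<cdot> t"
    using assms(1) unfolding sigma_iff by blast
  have "e \<cdot> (s \<cdot> c) = e \<cdot> (t \<cdot> c)"
    using e(2) S c idems_in[OF e(1)] assoc by metis
  then show ?thesis using S c e(1) closed unfolding sigma_iff by blast
qed

lemma congruence_sigma: "congruence sigma"
  unfolding congruence_def using equiv_sigma sigma_left sigma_right by blast

lemma idems_sigma_related:
  assumes "e \<in> idems" "f \<in> idems"
  shows "(e, f) \<in> sigma"
proof -
  note S = idems_in[OF assms(1)] idems_in[OF assms(2)]
  have "e \<cdot> f \<cdot> e = e \<cdot> e \<cdot> f"
    using idems_commute[OF assms(2,1)] S by (simp add: assoc)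
  also have "\<dots> = e \<cdot> f \<cdot> f"
    using assms S by (simp add: idems_idem assoc)
  finally show ?thesis using S idems_closed[OF assms] unfolding sigma_iff by blast
qed

section \<open>Congruences that respect maxima\<close>

lemma max_of_in_class:
  assumes "F_inverse" and a: "a \<in> S"
  shows "(a, max_of a) \<in> sigma"
proof -
  let ?P = "\<lambda>m. m \<in> sigma `` {a} \<and> (\<forall>b \<in> sigma `` {a}. nat_le b m)"
  have "sigma `` {a} \<in> S // sigma" using a by (rule quotientI)
  then obtain m where m: "?P m"
    using assms(1) unfolding F_inverse_def by blast
  have sub: "sigma `` {a} \<subseteq> S" by (auto simp: sigma_iff)
  have "?P (THE m. ?P m)"
    using m by (rule theI) (use m nat_le_antisym sub in blast)
  then show ?thesis unfolding max_of_def by blast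
qed

lemma F_congruence_sigma:
  assumes "F_inverse"
  shows "F_congruence sigma"
  unfolding F_congruence_def
proof (intro conjI ballI, rule congruence_sigma, clarify)
  fix a b assume ab: "(a, b) \<in> sigma"
  then have "a \<in> S" "b \<in> S" by (auto simp: sigma_iff)
  then show "(max_of a, max_of b) \<in> sigma"
    using ab max_of_in_class[OF assms] equiv_sigma by (meson equivE symD transD)
qed

text \<open>If \<open>\<sigma>\<close> is equality, \<open>max_of\<close> is the identity on \<open>S\<close>; if \<open>\<sigma>\<close> is universal, it is
  constant.  Either way it preserves every congruence.\<close>

lemma congruence_imp_F_congruence:
  assumes sig: "sigma = Id_on S \<or> sigma = S \<times> S"
    and F: "F_inverse" and \<rho>: "congruence \<rho>"
  shows "F_congruence \<rho>"
  unfolding F_congruence_def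
proof (intro conjI ballI, rule \<rho>, clarify)
  fix a b assume ab: "(a, b) \<in> \<rho>"
  have eq: "equiv S \<rho>" using \<rho> by (simp add: congruence_def)
  then have S: "a \<in> S" "b \<in> S" using ab by (auto simp: equiv_def)
  from sig show "(max_of a, max_of b) \<in> \<rho>"
  proof
    assume "sigma = Id_on S"
    then have "max_of a = a" "max_of b = b" using max_of_in_class[OF F] S by auto
    then show ?thesis using ab by simp
  next
    assume univ: "sigma = S \<times> S"
    then have "sigma `` {a} = sigma `` {b}" using S by auto
    then have "max_of a = max_of b" by (simp add: max_of_def)
    moreover have "max_of b \<in> S" using max_of_in_class[OF F S(2)] by (simp add: sigma_iff)
    ultimately show ?thesis using eq by (auto simp: equiv_def refl_on_def)
  qed
qed

lemma F_congruence_free_iff_congruence_free: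
  assumes "F_inverse"
  shows "F_congruence_free \<longleftrightarrow> congruence_free"
  using congruence_imp_F_congruence[OF _ assms] F_congruence_sigma[OF assms]
  unfolding F_congruence_free_def congruence_free_def F_congruence_def by blast

section \<open>Groups\<close>

lemma group_if_one_idem:
  assumes u: "idems = {u}"
  shows "group \<lparr>carrier = S, mult = mul, one = u\<rparr>"
proof (rule groupI; simp)
  have uS: "u \<in> S" using u idems_in by blast
  show "u \<in> S" by (fact uS)
  show "x \<cdot> y \<in> S" if "x \<in> S" "y \<in> S" for x y using that by (rule closed)
  show "x \<cdot> y \<cdot> z = x \<cdot> (y \<cdot> z)" if "x \<in> S" "y \<in> S" "z \<in> S" for x y z
    using that by (rule assoc)
  fix x assume x: "x \<in> S"
  obtain y where y: "y \<in> S" "x \<cdot> y \<cdot> x = x" "y \<cdot> x \<cdot> y = y" using obtain_inverse[OF x] .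
  have "x \<cdot> y = u" "y \<cdot> x = u"
    using mult_inverse_idem[OF x y(1,2)] mult_inverse_idem[OF y(1) x y(3)] u by auto
  then show "u \<cdot> x = x" "\<exists>y\<in>S. y \<cdot> x = u" using y by auto
qed

lemma group_idems:
  assumes "group \<lparr>carrier = S, mult = mul, one = u\<rparr>"
  shows "idems = {u}"
proof -
  interpret G: group "\<lparr>carrier = S, mult = mul, one = u\<rparr>" by fact
  show ?thesis
    using G.l_cancel_one G.r_cancel_one G.one_closed G.l_one unfolding idems_def by auto
qed

lemma F_inverse_monoid_group:
  assumes "group \<lparr>carrier = S, mult = mul, one = u\<rparr>"
  shows "F_inverse_monoid"
proof -
  interpret G: group "\<lparr>carrier = S, mult = mul, one = u\<rparr>" by fact
  have u: "u \<in> S" "\<And>a. a \<in> S \<Longrightarrow> u \<cdot> a = a" "\<And>a. a \<in> S \<Longrightarrow> a \<cdot> u = a"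
    using G.one_closed G.l_one G.r_one by auto
  have sig: "sigma = Id_on S"
    using group_idems[OF assms] u by (auto simp: sigma_def)
  have "\<exists>m\<in>C. \<forall>b\<in>C. nat_le b m" if "C \<in> S // sigma" for C
    using that nat_le_refl unfolding sig quotient_def by auto
  then show ?thesis unfolding F_inverse_monoid_def F_inverse_def using u by blast
qed

lemma congruence_of_normal:
  assumes "N \<lhd> \<lparr>carrier = S, mult = mul, one = u\<rparr>"
  obtains \<rho> where "congruence \<rho>" "\<And>a. (u, a) \<in> \<rho> \<longleftrightarrow> a \<in> N"
proof -
  let ?G = "\<lparr>carrier = S, mult = mul, one = u\<rparr>"
  interpret N: normal N ?G by fact
  let ?inv = "m_inv ?G"
  have inv: "?inv x \<in> S" if "x \<in> S" for x using N.inv_closed that by simp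
  have inv_mult: "?inv (x \<cdot> y) = ?inv y \<cdot> ?inv x" if "x \<in> S" "y \<in> S" for x y
    using N.inv_mult_group that by simp
  have cancel: "?inv x \<cdot> (x \<cdot> y) = y" if "x \<in> S" "y \<in> S" for x y
    using N.inv_solve_left[of y x "x \<cdot> y"] that closed by simp
  have conj: "?inv x \<cdot> h \<cdot> x \<in> N" if "x \<in> S" "h \<in> N" for x h
    using N.inv_op_closed1 that by simp
  have eq: "equiv S (rcong\<^bsub>?G\<^esub> N)"
    using N.equiv_rcong[OF N.is_group] by simp
  have "congruence (rcong\<^bsub>?G\<^esub> N)"
    unfolding congruence_def
  proof (intro conjI ballI, rule eq, clarify)
    fix a b c assume "(a, b) \<in> rcong\<^bsub>?G\<^esub> N" and c: "c \<in> S"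
    then have ab: "a \<in> S" "b \<in> S" "?inv a \<cdot> b \<in> N" by (auto simp: r_congruent_def)
    have "?inv (c \<cdot> a) \<cdot> (c \<cdot> b) = ?inv a \<cdot> b"
      using ab(1,2) c by (simp add: inv_mult inv closed assoc cancel)
    moreover have "?inv (a \<cdot> c) \<cdot> (b \<cdot> c) = ?inv c \<cdot> (?inv a \<cdot> b) \<cdot> c"
      using ab(1,2) c by (simp add: inv_mult inv closed assoc)
    ultimately show "(c \<cdot> a, c \<cdot> b) \<in> rcong\<^bsub>?G\<^esub> N \<and> (a \<cdot> c, b \<cdot> c) \<in> rcong\<^bsub>?G\<^esub> N"
      using ab c conj closed by (simp add: r_congruent_def)
  qed
  moreover have "(u, a) \<in> rcong\<^bsub>?G\<^esub> N \<longleftrightarrow> a \<in> N" for a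
    using N.inv_one N.l_one N.one_closed N.subset by (auto simp: r_congruent_def)
  ultimately show ?thesis using that by blast
qed

lemma normal_of_congruence:
  assumes "group \<lparr>carrier = S, mult = mul, one = u\<rparr>" and \<rho>: "congruence \<rho>"
  shows "{a. (u, a) \<in> \<rho>} \<lhd> \<lparr>carrier = S, mult = mul, one = u\<rparr>"
proof -
  let ?G = "\<lparr>carrier = S, mult = mul, one = u\<rparr>"
  let ?N = "{a. (u, a) \<in> \<rho>}"
  interpret G: group ?G by fact
  let ?inv = "m_inv ?G"
  have u: "u \<in> S" "\<And>a. a \<in> S \<Longrightarrow> u \<cdot> a = a" "\<And>a. a \<in> S \<Longrightarrow> a \<cdot> u = a"
    using G.one_closed G.l_one G.r_one by auto
  have inv: "?inv x \<in> S" "x \<cdot> ?inv x = u" "?inv x \<cdot> x = u" if "x \<in> S" for x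
    using G.inv_closed G.r_inv G.l_inv that by auto
  have eq: "equiv S \<rho>" and
    L: "\<And>a b c. (a, b) \<in> \<rho> \<Longrightarrow> c \<in> S \<Longrightarrow> (c \<cdot> a, c \<cdot> b) \<in> \<rho>" and
    R: "\<And>a b c. (a, b) \<in> \<rho> \<Longrightarrow> c \<in> S \<Longrightarrow> (a \<cdot> c, b \<cdot> c) \<in> \<rho>"
    using \<rho> unfolding congruence_def by auto
  have inS: "a \<in> S" if "(u, a) \<in> \<rho>" for a using eq that by (auto simp: equiv_def)
  have sym: "\<And>a b. (a, b) \<in> \<rho> \<Longrightarrow> (b, a) \<in> \<rho>"
    and tr: "\<And>a b c. (a, b) \<in> \<rho> \<Longrightarrow> (b, c) \<in> \<rho> \<Longrightarrow> (a, c) \<in> \<rho>"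
    using eq by (meson equivE symD, meson equivE transD)
  have "subgroup ?N ?G"
  proof (rule G.subgroupI)
    show "?N \<noteq> {}" using eq u(1) by (auto simp: equiv_def refl_on_def)
    show "?inv a \<in> ?N" if "a \<in> ?N" for a
      using that L[of u a "?inv a"] inS[of a] inv[of a] u(3)[of "?inv a"] sym by auto
    show "a \<otimes>\<^bsub>?G\<^esub> b \<in> ?N" if "a \<in> ?N" "b \<in> ?N" for a b
      using that L[of u b a] inS[of a] u tr by auto
  qed (use inS in auto)
  moreover have "x \<cdot> h \<cdot> ?inv x \<in> ?N" if "x \<in> S" "h \<in> ?N" for x h
    using R[OF L[of u h x], of "?inv x"] that inv[of x] u(3)[of x] by simp
  ultimately show ?thesis using G.normal_inv_iff by auto
qed

lemma simple_group_if_congruence_free: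
  assumes G: "group \<lparr>carrier = S, mult = mul, one = u\<rparr>"
    and cf: "congruence_free" and nontriv: "S \<noteq> {u}"
  shows "is_simple_group"
proof -
  let ?G = "\<lparr>carrier = S, mult = mul, one = u\<rparr>"
  have u: "u \<in> S" using group_idems[OF G] idems_in by blast
  have "N = S \<or> N = {u}" if "N \<lhd> ?G" for N
  proof -
    obtain \<rho> where \<rho>: "congruence \<rho>" and N: "\<And>a. (u, a) \<in> \<rho> \<longleftrightarrow> a \<in> N"
      using congruence_of_normal[OF \<open>N \<lhd> ?G\<close>] by blast
    have "\<rho> = Id_on S \<or> \<rho> = S \<times> S" using cf \<rho> unfolding congruence_free_def by blast
    then show ?thesis using N u by auto
  qed
  then show ?thesis unfolding is_simple_group_def Let_def using G nontriv by blast
qed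

text \<open>The class of the identity determines a congruence: \<open>a\<close> and \<open>b\<close> are related only if
  the quotient \<open>a\<^sup>-\<^sup>1 \<cdot> b\<close> lies in it.\<close>

lemma congruence_free_if_simple_group:
  assumes "is_simple_group"
  shows "congruence_free"
  unfolding congruence_free_def
proof (intro allI impI)
  fix \<rho> assume \<rho>: "congruence \<rho>"
  obtain u where G: "group \<lparr>carrier = S, mult = mul, one = u\<rparr>"
    and simple: "\<And>N. N \<lhd> \<lparr>carrier = S, mult = mul, one = u\<rparr> \<Longrightarrow> N = S \<or> N = {u}"
    using assms unfolding is_simple_group_def Let_def by blast
  interpret G: group "\<lparr>carrier = S, mult = mul, one = u\<rparr>" by fact
  let ?inv = "m_inv \<lparr>carrier = S, mult = mul, one = u\<rparr>"
  have eq: "equiv S \<rho>" and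
    L: "\<And>a b c. (a, b) \<in> \<rho> \<Longrightarrow> c \<in> S \<Longrightarrow> (c \<cdot> a, c \<cdot> b) \<in> \<rho>"
    using \<rho> unfolding congruence_def by auto
  from simple[OF normal_of_congruence[OF G \<rho>]] show "\<rho> = Id_on S \<or> \<rho> = S \<times> S"
  proof
    assume "{a. (u, a) \<in> \<rho>} = S"
    then have "\<And>a. a \<in> S \<Longrightarrow> (u, a) \<in> \<rho>" by auto
    then have "\<And>a b. a \<in> S \<Longrightarrow> b \<in> S \<Longrightarrow> (a, b) \<in> \<rho>"
      using eq by (meson equivE symD transD)
    then show ?thesis using eq by (auto simp: equiv_def)
  next
    assume triv: "{a. (u, a) \<in> \<rho>} = {u}"
    have "a = b" if "(a, b) \<in> \<rho>" for a b
    proof -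
      have S: "a \<in> S" "b \<in> S" using that eq by (auto simp: equiv_def)
      have ia: "?inv a \<in> S" using G.inv_closed S by simp
      have "(u, ?inv a \<cdot> b) \<in> \<rho>"
        using L[OF that ia] G.l_inv S by simp
      then have "?inv a \<cdot> b = u" using triv by blast
      then show ?thesis
      using G.inv_solve_left'[of u a b] G.r_one[of a] S G.one_closed by auto
    qed
    then show ?thesis using eq by (auto simp: equiv_def refl_on_def)
  qed
qed

section \<open>Semilattices\<close>

lemma sigma_semilattice:
  assumes "is_semilattice"
  shows "sigma = S \<times> S"
proof -
  have "idems = S" using assms unfolding is_semilattice_def idems_def by blast
  then show ?thesis using idems_sigma_related by (auto simp: sigma_iff)
qed

lemma semilattice_if_all_idem:
  assumes "idems = S"
  shows "is_semilattice"
  unfolding is_semilattice_def using assms idems_idem idems_commute by blast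

text \<open>With two elements, their product is one of them and the other one is the identity.\<close>

lemma F_inverse_monoid_semilattice_card_le_2:
  assumes sl: "is_semilattice" and fin: "finite S" and card: "card S \<le> 2"
  shows "F_inverse_monoid"
proof -
  have sl': "\<And>a. a \<in> S \<Longrightarrow> a \<cdot> a = a" "\<And>a b. a \<in> S \<Longrightarrow> b \<in> S \<Longrightarrow> a \<cdot> b = b \<cdot> a"
    using sl unfolding is_semilattice_def by auto
  have idems: "idems = S" using sl' by (auto simp: idems_def)
  obtain u where u: "u \<in> S" "\<And>a. a \<in> S \<Longrightarrow> a \<cdot> u = a"
  proof -
    have "card S = 1 \<or> card S = 2" using card nonempty fin by (cases "card S") auto
    then obtain x y where xy: "S = {x, y}"
      by (auto simp: card_1_singleton_iff card_2_iff)
    then have S: "x \<in> S" "y \<in> S" and mem: "\<And>a. a \<in> S \<Longrightarrow> a = x \<or> a = y" by auto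
    from mem[OF closed[OF S]] show ?thesis
    proof
      assume "x \<cdot> y = x"
      then have "a \<cdot> y = a" if "a \<in> S" for a using mem[OF that] sl'(1)[OF S(2)] by blast
      then show ?thesis using that[OF S(2)] by blast
    next
      assume "x \<cdot> y = y"
      then have "y \<cdot> x = y" using sl'(2)[OF S] by metis
      then have "a \<cdot> x = a" if "a \<in> S" for a using mem[OF that] sl'(1)[OF S(1)] by blast
      then show ?thesis using that[OF S(1)] by blast
    qed
  qed
  have "S // sigma = {S}" unfolding sigma_semilattice[OF sl] quotient_def using u(1) by auto
  moreover have "nat_le b u" if "b \<in> S" for b
    unfolding nat_le_def idems using that u by metis
  moreover have "u \<cdot> a = a" if "a \<in> S" for a
    using sl'(2)[OF u(1) that] u(2)[OF that] by metis
  ultimately show ?thesis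
    unfolding F_inverse_monoid_def F_inverse_def using u by blast
qed

lemma congruence_free_if_card_le_2:
  assumes fin: "finite S" and card: "card S \<le> 2"
  shows "congruence_free"
  unfolding congruence_free_def
proof (intro allI impI)
  fix \<rho> assume "congruence \<rho>"
  then have eq: "equiv S \<rho>" by (simp add: congruence_def)
  have sub: "\<rho> \<subseteq> S \<times> S" and refl: "\<And>a. a \<in> S \<Longrightarrow> (a, a) \<in> \<rho>"
    and sym: "\<And>a b. (a, b) \<in> \<rho> \<Longrightarrow> (b, a) \<in> \<rho>"
    using eq by (auto simp: equiv_def refl_on_def sym_def)
  have "card S = 1 \<or> card S = 2" using card nonempty fin by (cases "card S") auto
  then obtain x y where xy: "S = {x, y}"
    by (auto simp: card_1_singleton_iff card_2_iff)
  show "\<rho> = Id_on S \<or> \<rho> = S \<times> S"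
  proof (cases "(x, y) \<in> \<rho>")
    case True
    then have "S \<times> S \<subseteq> \<rho>" using refl sym xy by auto
    then show ?thesis using sub by auto
  next
    case False
    then have "(y, x) \<notin> \<rho>" using sym by blast
    then have "\<rho> \<subseteq> Id_on S" using sub False xy by auto
    moreover have "Id_on S \<subseteq> \<rho>" using refl by auto
    ultimately show ?thesis by blast
  qed
qed

text \<open>A product lies above \<open>a\<close> exactly when both factors do, so membership in the principal
  filter of \<open>a\<close> is a homomorphism to the two-element semilattice; the relation is its
  kernel.\<close>

lemma congruence_filter:
  assumes sl: "is_semilattice" and a: "a \<in> S"
  shows "congruence {(x, y) \<in> S \<times> S. a \<cdot> x = a \<longleftrightarrow> a \<cdot> y = a}" (is "congruence ?\<rho>")
proof -
  have sl': "\<And>a. a \<in> S \<Longrightarrow> a \<cdot> a = a" "\<And>a b. a \<in> S \<Longrightarrow> b \<in> S \<Longrightarrow> a \<cdot> b = b \<cdot> a"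
    using sl unfolding is_semilattice_def by auto
  have meet_left: "a \<cdot> x = a" if "x \<in> S" "c \<in> S" "a \<cdot> (x \<cdot> c) = a" for x c
  proof -
    have "a \<cdot> x = a \<cdot> (x \<cdot> c) \<cdot> x" using that by simp
    also have "\<dots> = a \<cdot> (x \<cdot> x \<cdot> c)" using that(1,2) a sl'(2)[of c x] by (simp add: assoc closed)
    finally show ?thesis using that sl'(1) by simp
  qed
  have meet: "a \<cdot> (x \<cdot> c) = a \<longleftrightarrow> a \<cdot> x = a \<and> a \<cdot> c = a" if "x \<in> S" "c \<in> S" for x c
    using that meet_left[of x c] meet_left[of c x] sl'(2)[of x c] assoc[of a x c] a by auto
  have "equiv S ?\<rho>"
    by (rule equivI) (auto simp: refl_on_def sym_def trans_def)
  then show ?thesis unfolding congruence_def using meet closed by auto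
qed

text \<open>Of two distinct elements one, say \<open>a\<close>, is not below the other, so the filter
  congruence of \<open>a\<close> is not universal.  It is then equality, yet has at most two classes.\<close>

lemma congruence_free_semilattice_card:
  assumes sl: "is_semilattice" and cf: "congruence_free"
  shows "finite S \<and> card S \<le> 2"
proof (cases "\<exists>a\<in>S. \<exists>b\<in>S. a \<noteq> b")
  case True
  have sl': "\<And>a. a \<in> S \<Longrightarrow> a \<cdot> a = a" "\<And>a b. a \<in> S \<Longrightarrow> b \<in> S \<Longrightarrow> a \<cdot> b = b \<cdot> a"
    using sl unfolding is_semilattice_def by auto
  obtain a b where ab: "a \<in> S" "b \<in> S" "a \<cdot> b \<noteq> a"
    using True sl'(2) by metis
  let ?\<rho> = "{(x, y) \<in> S \<times> S. a \<cdot> x = a \<longleftrightarrow> a \<cdot> y = a}"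
  have "(a, b) \<notin> ?\<rho>" using ab sl'(1) by auto
  then have "?\<rho> \<noteq> S \<times> S" using ab by blast
  then have id: "?\<rho> = Id_on S"
    using cf congruence_filter[OF sl ab(1)] unfolding congruence_free_def by blast
  have "inj_on (\<lambda>x. a \<cdot> x = a) S"
  proof (rule inj_onI)
    fix x y assume "x \<in> S" "y \<in> S" "(a \<cdot> x = a) = (a \<cdot> y = a)"
    then have "(x, y) \<in> ?\<rho>" by auto
    then show "x = y" unfolding id by auto
  qed
  then show ?thesis
    using inj_on_finite[of "\<lambda>x. a \<cdot> x = a" S UNIV] card_inj_on_le[of "\<lambda>x. a \<cdot> x = a" S UNIV]
    by (auto simp: card_UNIV_bool)
next
  case False
  obtain a where "a \<in> S" using nonempty by blast
  with False have "S = {a}" by blast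
  then show ?thesis by simp
qed

section \<open>The classification\<close>

lemma E_unitary_sigma_universal:
  assumes "E_unitary" and univ: "sigma = S \<times> S"
  shows "idems = S"
proof
  show "idems \<subseteq> S" using idems_in by blast
  show "S \<subseteq> idems"
  proof
    fix s assume s: "s \<in> S"
    obtain e where e: "e \<in> idems"
      using s obtain_inverse mult_inverse_idem by metis
    have "(e, s) \<in> sigma" using univ s idems_in[OF e] by blast
    then obtain f where f: "f \<in> idems" "f \<cdot> e = f \<cdot> s" unfolding sigma_iff by blast
    \<comment> \<open>The idempotent \<open>f \<cdot> e\<close> lies below \<open>s\<close>.\<close>
    then have "nat_le (f \<cdot> e) s" unfolding nat_le_def by blast
    then show "s \<in> idems"
      using assms(1) idems_closed[OF f(1) e] s unfolding E_unitary_def by blast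
  qed
qed

lemma congruence_free_classification:
  assumes "E_unitary" and cf: "congruence_free"
  shows "is_simple_group \<or> (is_semilattice \<and> finite S \<and> card S \<le> 2)"
proof -
  have "sigma = Id_on S \<or> sigma = S \<times> S"
    using cf congruence_sigma unfolding congruence_free_def by blast
  then show ?thesis
  proof
    assume id: "sigma = Id_on S"
    obtain u where u: "u \<in> idems"
      using nonempty obtain_inverse mult_inverse_idem by (metis all_not_in_conv)
    then have idems: "idems = {u}" using idems_sigma_related id by blast
    show ?thesis
    proof (cases "S = {u}")
      case True
      then have "is_semilattice" using semilattice_if_all_idem[OF trans[OF idems]] by blast
      then show ?thesis using True by simp
    next
      case False
      then show ?thesis
        using simple_group_if_congruence_free[OF group_if_one_idem[OF idems] cf] by blast
    qed
  next
    assume "sigma = S \<times> S"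
    then have "is_semilattice"
      using E_unitary_sigma_universal[OF assms(1)] semilattice_if_all_idem by blast
    then show ?thesis using congruence_free_semilattice_card[OF _ cf] by blast
  qed
qed

lemma F_inverse_monoid_if_classified:
  assumes "is_simple_group \<or> (is_semilattice \<and> finite S \<and> card S \<le> 2)"
  shows "F_inverse_monoid"
  using assms F_inverse_monoid_group F_inverse_monoid_semilattice_card_le_2
  unfolding is_simple_group_def Let_def by blast

end

theorem theorem7p3:
  fixes S :: "'a set" and mul :: "'a \<Rightarrow> 'a \<Rightarrow> 'a"
  assumes "inverse_semigroup S mul"
    and "inverse_semigroup.E_unitary S mul"
  shows "((inverse_semigroup.F_inverse_monoid S mul \<and> inverse_semigroup.F_congruence_free S mul)
            \<longleftrightarrow> inverse_semigroup.congruence_free S mul) \<and>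
         (inverse_semigroup.congruence_free S mul
            \<longleftrightarrow> inverse_semigroup.is_simple_group S mul \<or>
                (inverse_semigroup.is_semilattice S mul \<and> finite S \<and> card S \<le> 2))"
proof -
  interpret inverse_semigroup S mul by fact
  have free_iff: "congruence_free \<longleftrightarrow> is_simple_group \<or> (is_semilattice \<and> finite S \<and> card S \<le> 2)"
    using congruence_free_classification[OF assms(2)] congruence_free_if_simple_group
      congruence_free_if_card_le_2 by blast
  moreover have "F_inverse_monoid \<and> F_congruence_free \<longleftrightarrow> congruence_free"
    using F_congruence_free_iff_congruence_free F_inverse_monoid_if_classified free_iff
    unfolding F_inverse_monoid_def by blast
  ultimately show ?thesis by blast
qed

end
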